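(* Let $\mathcal{A}$ be a real symmetric tensor of order $m$ and dimension $n$. Then $\mathcal{A}$ is semi-positive if and only if it is copositive.
   Context: $m,n$ are positive integers and $I_n = \{1,2,\dots,n\}$. A real tensor of order $m$ and dimension $n$ is a multi-array $\mathcal{A} = (a_{i_1\cdots i_m})$ of real numbers with $i_j \in I_n$ for $j = 1,\dots,m$. It is symmetric if its entries $a_{i_1\cdots i_m}$ are invariant under any permutation of their indices. For $\mathbf{x} \in \mathbb{R}^n$, $\mathcal{A}\mathbf{x}^{m-1} \in \mathbb{R}^n$ is the vector with components $(\mathcal{A}\mathbf{x}^{m-1})_i = \sum_{i_2,\dots,i_m=1}^n a_{i i_2\cdots i_m} x_{i_2}\cdots x_{i_m}$, $i \in I_n$, and $\mathcal{A}\mathbf{x}^m = \mathbf{x}^\top(\mathcal{A}\mathbf{x}^{m-1}) = \sum_{i_1,\dots,i_m=1}^n a_{i_1\cdots i_m}x_{i_1}\cdots x_{i_m}$. $\mathbf{x} \geq \mathbf{0}$ means $x_i \geq 0$ for all $i \in I_n$, and $\mathbb{R}^n_+ = \{\mathbf{x} \in \mathbb{R}^n : \mathbf{x} \geq \mathbf{0}\}$. $\mathcal{A}$ is semi-positive iff for each $\mathbf{x} \in \mathbb{R}^n$ with $\mathbf{x} \geq \mathbf{0}$ and $\mathbf{x} \neq \mathbf{0}$ there exists $k \in I_n$ such that $x_k > 0$ and $(\mathcal{A}\mathbf{x}^{m-1})_k \geq 0$. $\mathcal{A}$ is copositive iff $\mathcal{A}\mathbf{x}^m \geq 0$ for all $\mathbf{x}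 \in \mathbb{R}^n_+$. *)

theory Defs
  imports "HOL-Analysis.Analysis"
begin

text \<open>
  The index set of cardinality \<open>n\<close> is a finite type \<open>'n\<close>, with \<open>n = CARD('n) \<ge> 1\<close>.
  A tensor of order \<open>m\<close> and dimension \<open>n\<close> is a function \<open>A :: 'n list \<Rightarrow> real\<close>, the entry
  with indices \<open>i1, \<dots>, im\<close> being \<open>A [i1, \<dots>, im]\<close>. Since the order is not determined by the
  type, it is an argument of all notions below; values of \<open>A\<close> at lists of length other
  than \<open>m\<close> are never used when \<open>m \<ge> 1\<close>.
\<close>

definition symmetric_tensor :: "nat \<Rightarrow> ('n::finite list \<Rightarrow> real) \<Rightarrow> bool" where
  "symmetric_tensor m A \<longleftrightarrow>
     (\<forall>is p. length is = m \<and> p permutes {..<m} \<longrightarrow> A (permute_list p is) = A is)"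

text \<open>The vector \<open>A x^(m-1)\<close>; the list \<open>js\<close> stands for \<open>[i2, \<dots>, im]\<close>.\<close>

definition tensor_apply :: "nat \<Rightarrow> ('n::finite list \<Rightarrow> real) \<Rightarrow> real ^ 'n \<Rightarrow> real ^ 'n" where
  "tensor_apply m A x =
     (\<chi> i. \<Sum>js | length js = m - 1. A (i # js) * (\<Prod>j\<leftarrow>js. x $ j))"

text \<open>The scalar \<open>A x^m\<close>.\<close>

definition tensor_form :: "nat \<Rightarrow> ('n::finite list \<Rightarrow> real) \<Rightarrow> real ^ 'n \<Rightarrow> real" where
  "tensor_form m A x = x \<bullet> tensor_apply m A x"

lemma tensor_form_eq_sum:
  fixes A :: "'n::finite list \<Rightarrow> real"
  assumes "m \<ge> 1"
  shows "tensor_form m A x = (\<Sum>is | length is = m. A is * (\<Prod>i\<leftarrow>is. x $ i))"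
proof -
  let ?L = "{js :: 'n list. length js = m - 1}"
  have "tensor_form m A x =
      (\<Sum>i\<in>UNIV. \<Sum>js\<in>?L. A (i # js) * (\<Prod>j\<leftarrow>i # js. x $ j))"
    by (simp add: tensor_form_def tensor_apply_def inner_vec_def sum_distrib_left mult_ac)
  also have "\<dots> = (\<Sum>(i, js)\<in>UNIV \<times> ?L. A (i # js) * (\<Prod>j\<leftarrow>i # js. x $ j))"
    by (rule sum.cartesian_product)
  also have "\<dots> = (\<Sum>is | length is = m. A is * (\<Prod>i\<leftarrow>is. x $ i))"
    using assms
    by (intro sum.reindex_bij_witness[of _ "\<lambda>is. (hd is, tl is)" "\<lambda>(i, js). i # js"])
       (auto simp: Suc_le_eq)
  finally show ?thesis .
qed

text \<open>The order on \<open>real ^ 'n\<close> is componentwise.\<close>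

definition semi_positive :: "nat \<Rightarrow> ('n::finite list \<Rightarrow> real) \<Rightarrow> bool" where
  "semi_positive m A \<longleftrightarrow>
     (\<forall>x :: real ^ 'n. x \<ge> 0 \<and> x \<noteq> 0 \<longrightarrow> (\<exists>k. x $ k > 0 \<and> tensor_apply m A x $ k \<ge> 0))"

definition copositive :: "nat \<Rightarrow> ('n::finite list \<Rightarrow> real) \<Rightarrow> bool" where
  "copositive m A \<longleftrightarrow> (\<forall>x :: real ^ 'n. x \<ge> 0 \<longrightarrow> tensor_form m A x \<ge> 0)"

end

theory Submission
  imports Defs
begin

text \<open>
  That a copositive tensor is semi-positive is immediate: if all components of
  \<open>A x\<^sup>m\<^sup>-\<^sup>1\<close> on the support of \<open>x \<ge> 0\<close> were negative, then so would be
  \<open>A x\<^sup>m = x \<bullet> A x\<^sup>m\<^sup>-\<^sup>1\<close>.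

  For the converse, let \<open>A\<close> be semi-positive and suppose that \<open>A y\<^sup>m < 0\<close> for some \<open>y \<ge> 0\<close>.
  By homogeneity \<open>y\<close> can be scaled into the standard simplex, so that the form \<open>A x\<^sup>m\<close> attains a
  negative minimum over this compact set, at \<open>x\<close> say. Since \<open>x \<bullet> A x\<^sup>m\<^sup>-\<^sup>1 < 0\<close>, there is an index
  \<open>l\<close> with \<open>(A x\<^sup>m\<^sup>-\<^sup>1)\<^sub>l < 0\<close>, and semi-positivity yields \<open>k\<close> in the support of \<open>x\<close> with
  \<open>(A x\<^sup>m\<^sup>-\<^sup>1)\<^sub>k \<ge> 0\<close>. Symmetry makes \<open>m A x\<^sup>m\<^sup>-\<^sup>1\<close> the gradient of the form
  (\<open>tensor_form_has_derivative\<close>), so moving a little mass from coordinate \<open>k\<close> to coordinate \<open>l\<close>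
  stays in the simplex and decreases the form below its minimum.
\<close>

section \<open>The gradient of a symmetric form\<close>

lemma prod_list_map_nth_eq_prod:
  fixes x :: "'n \<Rightarrow> 'a::comm_monoid_mult"
  shows "(\<Prod>i\<leftarrow>is. x i) = (\<Prod>j<length is. x (is ! j))"
  by (simp add: prod.list_conv_set_nth atLeast0LessThan)

lemma inner_tensor_apply_eq_sum:
  fixes A :: "'n::finite list \<Rightarrow> real"
  assumes "m \<ge> 1"
  shows "v \<bullet> tensor_apply m A x =
    (\<Sum>is | length is = m. A is * (v $ (is ! 0) * (\<Prod>j\<in>{..<m} - {0}. x $ (is ! j))))"
proof -
  let ?L = "{js :: 'n list. length js = m - 1}"
  have tail: "(\<Prod>j\<leftarrow>js. x $ j) = (\<Prod>j\<in>{..<m} - {0}. x $ ((i # js) ! j))"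
    if "length js = m - 1" for i js
  proof -
    have "(\<Prod>j\<leftarrow>js. x $ j) = (\<Prod>j<m - 1. x $ (js ! j))"
      using that by (simp add: prod_list_map_nth_eq_prod)
    also have "\<dots> = (\<Prod>j\<in>{..<m} - {0}. x $ ((i # js) ! j))"
      by (rule prod.reindex_bij_witness[of _ "\<lambda>j. j - 1" Suc]) auto
    finally show ?thesis .
  qed
  have "v \<bullet> tensor_apply m A x =
      (\<Sum>i\<in>UNIV. \<Sum>js\<in>?L. A (i # js) * (v $ i * (\<Prod>j\<in>{..<m} - {0}. x $ ((i # js) ! j))))"
  proof (simp only: tensor_apply_def inner_vec_def vec_lambda_beta inner_real_def
      sum_distrib_left, intro sum.cong refl)
    fix i js assume "js \<in> ?L"
    then show "v $ i * (A (i # js) * (\<Prod>j\<leftarrow>js. x $ j)) =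
        A (i # js) * (v $ i * (\<Prod>j\<in>{..<m} - {0}. x $ ((i # js) ! j)))"
      by (simp only: tail[of js i] mem_Collect_eq mult.left_commute)
  qed
  also have "\<dots> = (\<Sum>(i, js)\<in>UNIV \<times> ?L.
      A (i # js) * (v $ i * (\<Prod>j\<in>{..<m} - {0}. x $ ((i # js) ! j))))"
    by (rule sum.cartesian_product)
  also have "\<dots> =
      (\<Sum>is | length is = m. A is * (v $ (is ! 0) * (\<Prod>j\<in>{..<m} - {0}. x $ (is ! j))))"
    using assms
    by (intro sum.reindex_bij_witness[of _ "\<lambda>is. (hd is, tl is)" "\<lambda>(i, js). i # js"])
       (auto simp: Suc_le_eq)
  finally show ?thesis .
qed

text \<open>
  Exchanging the indices at positions \<open>0\<close> and \<open>j\<close> permutes the index tuples and leaves the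
  entries of a symmetric tensor unchanged, so it does not matter into which argument of the
  multilinear form the vector \<open>v\<close> is inserted.
\<close>

lemma symmetric_tensor_insert_at:
  fixes A :: "'n::finite list \<Rightarrow> real"
  assumes "symmetric_tensor m A" "j < m"
  shows "(\<Sum>is | length is = m. A is * (v $ (is ! j) * (\<Prod>k\<in>{..<m} - {j}. x $ (is ! k)))) =
    v \<bullet> tensor_apply m A x"
proof -
  let ?p = "Transposition.transpose 0 j"
  have p: "?p permutes {..<m}"
    using assms(2) by (intro permutes_swap_id) auto
  have m: "m \<ge> 1" using assms(2) by simp
  have nth: "permute_list ?p is ! k = is ! ?p k" if "length is = m" "k < m" for "is" :: "'n list" and k
    using p that by (simp add: permute_list_nth)
  have invol: "permute_list ?p (permute_list ?p is) = is" if "length is = m" for "is" :: "'n list"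
    using p that permute_list_compose[of ?p "is" ?p] by simp
  have prod: "(\<Prod>k\<in>{..<m} - {j}. x $ (permute_list ?p is ! k)) =
      (\<Prod>k\<in>{..<m} - {0}. x $ (is ! k))" if "length is = m" for "is"
  proof (rule prod.reindex_bij_witness[of _ ?p ?p])
    fix k assume "k \<in> {..<m} - {j}"
    then show "?p k \<in> {..<m} - {0}" "x $ (is ! ?p k) = x $ (permute_list ?p is ! k)"
      using assms(2) that by (auto simp: nth Transposition.transpose_def)
  next
    fix k assume "k \<in> {..<m} - {0}"
    then show "?p k \<in> {..<m} - {j}"
      using assms(2) by (auto simp: Transposition.transpose_def)
  qed simp_all
  have "(\<Sum>is | length is = m. A is * (v $ (is ! j) * (\<Prod>k\<in>{..<m} - {j}. x $ (is ! k)))) =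
      (\<Sum>is | length is = m. A is * (v $ (is ! 0) * (\<Prod>k\<in>{..<m} - {0}. x $ (is ! k))))"
  proof (rule sum.reindex_bij_witness[of _ "permute_list ?p" "permute_list ?p"])
    fix "is" :: "'n list" assume "is \<in> {is. length is = m}"
    then have l: "length is = m" by simp
    define js where "js = permute_list ?p is"
    have ljs: "length js = m" and "is": "permute_list ?p js = is"
      using l by (simp_all add: js_def invol)
    have "A is = A js"
      using assms(1) l p by (simp add: symmetric_tensor_def js_def)
    moreover have "is ! j = js ! 0"
      using nth[OF ljs assms(2)] by (simp add: "is")
    ultimately show "A (permute_list ?p is) *
        (v $ (permute_list ?p is ! 0) * (\<Prod>k\<in>{..<m} - {0}. x $ (permute_list ?p is ! k))) =
        A is * (v $ (is ! j) * (\<Prod>k\<in>{..<m} - {j}. x $ (is ! k)))"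
      using prod[OF ljs] by (simp add: "is" flip: js_def)
  qed (simp_all add: invol)
  then show ?thesis
    by (simp add: inner_tensor_apply_eq_sum[OF m])
qed

text \<open>
  The product rule inserts \<open>v\<close> into each of the \<open>m\<close> arguments in turn, and by symmetry these \<open>m\<close>
  contributions coincide.
\<close>

lemma tensor_form_has_derivative:
  fixes A :: "'n::finite list \<Rightarrow> real"
  assumes "m \<ge> 1" "symmetric_tensor m A"
  shows "((\<lambda>t. tensor_form m A (x + t *\<^sub>R v)) has_real_derivative
    real m * (v \<bullet> tensor_apply m A x)) (at 0)"
proof -
  have form: "(\<lambda>t. tensor_form m A (x + t *\<^sub>R v)) =
      (\<lambda>t. \<Sum>is | length is = m. A is * (\<Prod>j<m. x $ (is ! j) + t * v $ (is ! j)))"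
    by (auto simp: tensor_form_eq_sum[OF assms(1)] prod_list_map_nth_eq_prod)
  have D: "((\<lambda>t. \<Prod>j<m. x $ (is ! j) + t * v $ (is ! j)) has_real_derivative
      (\<Sum>j<m. v $ (is ! j) * (\<Prod>k\<in>{..<m} - {j}. x $ (is ! k)))) (at 0)" for "is"
    by (rule has_field_derivative_prod[THEN DERIV_cong]) (auto intro!: derivative_eq_intros)
  have "((\<lambda>t. tensor_form m A (x + t *\<^sub>R v)) has_real_derivative
      (\<Sum>is | length is = m. A is * (\<Sum>j<m. v $ (is ! j) * (\<Prod>k\<in>{..<m} - {j}. x $ (is ! k)))))
      (at 0)"
    unfolding form by (intro DERIV_sum DERIV_cmult D)
  also have "(\<Sum>is | length is = m.
        A is * (\<Sum>j<m. v $ (is ! j) * (\<Prod>k\<in>{..<m} - {j}. x $ (is ! k)))) =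
      (\<Sum>j<m. \<Sum>is | length is = m.
        A is * (v $ (is ! j) * (\<Prod>k\<in>{..<m} - {j}. x $ (is ! k))))"
    unfolding sum_distrib_left by (rule sum.swap)
  also have "\<dots> = real m * (v \<bullet> tensor_apply m A x)"
    by (simp add: symmetric_tensor_insert_at[OF assms(2)])
  finally show ?thesis .
qed

section \<open>Minimizing the form over the standard simplex\<close>

lemma tensor_form_scaleR:
  fixes A :: "'n::finite list \<Rightarrow> real"
  assumes "m \<ge> 1"
  shows "tensor_form m A (c *\<^sub>R x) = c ^ m * tensor_form m A x"
  by (auto simp: tensor_form_eq_sum[OF assms] prod_list_map_nth_eq_prod prod.distrib
      sum_distrib_left mult_ac intro!: sum.cong)

lemma continuous_on_tensor_form:
  fixes A :: "'n::finite list \<Rightarrow> real"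
  assumes "m \<ge> 1"
  shows "continuous_on S (tensor_form m A)"
  unfolding tensor_form_eq_sum[OF assms] prod_list_map_nth_eq_prod
  by (intro continuous_intros)

definition standard_simplex :: "(real ^ 'n::finite) set" where
  "standard_simplex = {x. x \<ge> 0 \<and> (\<Sum>i\<in>UNIV. x $ i) = 1}"

lemma compact_standard_simplex: "compact (standard_simplex :: (real ^ 'n::finite) set)"
proof (rule compact_eq_bounded_closed[THEN iffD2], intro conjI)
  have "norm x \<le> 1" if "x \<in> standard_simplex" for x :: "real ^ 'n"
    using norm_le_l1_cart[of x] that
    by (simp add: standard_simplex_def less_eq_vec_def)
  then show "bounded (standard_simplex :: (real ^ 'n) set)"
    unfolding bounded_iff by blast
  show "closed (standard_simplex :: (real ^ 'n) set)"
    unfolding standard_simplex_def less_eq_vec_def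
    by (intro closed_Collect_conj closed_Collect_all closed_Collect_le closed_Collect_eq
        continuous_intros)
qed

lemma tensor_form_eq_0: "tensor_form m A 0 = 0"
  by (simp add: tensor_form_def)

lemma copositive_imp_semi_positive:
  fixes A :: "'n::finite list \<Rightarrow> real"
  assumes "copositive m A"
  shows "semi_positive m A"
  unfolding semi_positive_def
proof (intro allI impI, rule ccontr)
  fix x :: "real ^ 'n"
  assume x: "x \<ge> 0 \<and> x \<noteq> 0"
    and "\<not> (\<exists>k. x $ k > 0 \<and> tensor_apply m A x $ k \<ge> 0)"
  then have neg: "tensor_apply m A x $ k < 0" if "x $ k > 0" for k
    using that by force
  have nonneg: "x $ k \<ge> 0" for k
    using x by (simp add: less_eq_vec_def)
  obtain l where "x $ l \<noteq> 0"
    using x by (auto simp: vec_eq_iff)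
  then have l: "x $ l > 0"
    using nonneg[of l] by simp
  have "tensor_form m A x = (\<Sum>k\<in>UNIV. x $ k * tensor_apply m A x $ k)"
    by (simp add: tensor_form_def inner_vec_def)
  also have "\<dots> < (\<Sum>k\<in>(UNIV :: 'n set). 0)"
  proof (rule sum_strict_mono_ex1)
    show "\<forall>k\<in>UNIV. x $ k * tensor_apply m A x $ k \<le> 0"
      using neg nonneg by (metis linorder_not_less mult_nonneg_nonpos mult_zero_left
          order.strict_iff_order order_antisym_conv)
    show "\<exists>k\<in>UNIV. x $ k * tensor_apply m A x $ k < 0"
      using l neg[OF l] by (auto intro: mult_pos_neg)
  qed simp
  finally show False
    using assms x by (auto simp: copositive_def dest: spec[of _ x])
qed

lemma semi_positive_imp_copositive:
  fixes A :: "'n::finite list \<Rightarrow> real"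
  assumes m: "m \<ge> 1" and sym: "symmetric_tensor m A" and semi: "semi_positive m A"
  shows "copositive m A"
proof (rule ccontr)
  assume "\<not> copositive m A"
  then obtain y :: "real ^ 'n" where y: "y \<ge> 0" "tensor_form m A y < 0"
    by (auto simp: copositive_def not_le)
  define s where "s = (\<Sum>i\<in>UNIV. y $ i)"
  have y_nonneg: "y $ i \<ge> 0" for i
    using y(1) by (simp add: less_eq_vec_def)
  have "s \<noteq> 0"
  proof
    assume "s = 0"
    then have "y = 0"
      using y_nonneg by (simp add: s_def sum_nonneg_eq_0_iff vec_eq_iff)
    then show False
      using y(2) by (simp add: tensor_form_eq_0)
  qed
  moreover have "s \<ge> 0"
    using y_nonneg by (simp add: s_def sum_nonneg)
  ultimately have s: "s > 0" by simp
  define z where "z = inverse s *\<^sub>R y"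
  have z: "z \<in> standard_simplex"
    using s y_nonneg
    by (auto simp: z_def standard_simplex_def less_eq_vec_def s_def simp flip: sum_distrib_left)
  have z_neg: "tensor_form m A z < 0"
    using s y(2) by (simp add: z_def tensor_form_scaleR[OF m] mult_pos_neg)

  obtain x where x: "x \<in> standard_simplex"
    and min: "\<And>w. w \<in> standard_simplex \<Longrightarrow> tensor_form m A x \<le> tensor_form m A w"
    using continuous_attains_inf[OF compact_standard_simplex _ continuous_on_tensor_form[OF m]] z
    by blast
  have x_nonneg: "x $ i \<ge> 0" for i
    using x by (simp add: standard_simplex_def less_eq_vec_def)
  have "x \<ge> 0 \<and> x \<noteq> 0"
    using x by (auto simp: standard_simplex_def)
  then obtain k where k: "x $ k > 0" "tensor_apply m A x $ k \<ge> 0"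
    using semi by (auto simp: semi_positive_def)
  have "tensor_form m A x < 0"
    using min[OF z] z_neg by simp
  then have "\<not> (\<forall>l. tensor_apply m A x $ l \<ge> 0)"
    using x_nonneg by (auto simp: tensor_form_def inner_vec_def not_le[symmetric] intro!: sum_nonneg)
  then obtain l where l: "tensor_apply m A x $ l < 0"
    by (auto simp: not_le)
  define v :: "real ^ 'n" where "v = axis l 1 - axis k 1"
  have descent: "real m * (v \<bullet> tensor_apply m A x) < 0"
    using k(2) l m by (simp add: v_def inner_diff_left inner_axis' mult_pos_neg)
  obtain d where d: "d > 0"
    "\<And>h. 0 < h \<Longrightarrow> h < d \<Longrightarrow> tensor_form m A (x + h *\<^sub>R v) < tensor_form m A x"
    using DERIV_neg_dec_right[OF tensor_form_has_derivative[OF m sym] descent] by auto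
  \<comment> \<open>The bound \<open>x $ k\<close> keeps coordinate \<open>k\<close>, the only one that decreases, nonnegative.\<close>
  define h where "h = min (d / 2) (x $ k)"
  have h: "0 < h" "h < d" "h \<le> x $ k"
    using d(1) k(1) by (auto simp: h_def)
  have "(\<Sum>i\<in>UNIV. (x + h *\<^sub>R v) $ i) = 1"
    using x by (simp add: v_def standard_simplex_def axis_def algebra_simps sum.distrib
        sum_subtractf if_distrib[of "\<lambda>u. _ * u"] cong: if_cong)
  moreover have "(x + h *\<^sub>R v) $ i \<ge> 0" for i
    using x_nonneg[of i] h by (auto simp: v_def axis_def)
  ultimately have "x + h *\<^sub>R v \<in> standard_simplex"
    by (simp add: standard_simplex_def less_eq_vec_def)
  then show False
    using min d(2)[OF h(1,2)] by fastforce
qed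

theorem theorem3p3:
  fixes m :: nat and A :: "'n::finite list \<Rightarrow> real"
  assumes "m \<ge> 1"
    and "symmetric_tensor m A"
  shows "semi_positive m A \<longleftrightarrow> copositive m A"
  using assms copositive_imp_semi_positive semi_positive_imp_copositive by blast

end
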